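(* Let $m\ge 1$. Assume that $\Phi=(\Phi_1,\dots,\Phi_m)$ is continuous and verifies property $\mathcal P(\alpha,\mathfrak a)$ (see context) for some $(\alpha,\mathfrak a)\in[0,1]^{\frac{m(m+1)}{2}}\times\mathbb R_+$ satisfying, for $1\le j\le i$, $$\frac{m-i-1}{m-i}<\alpha_{ij}\le 1\quad\text{for } i=1,\dots,m-1,\qquad 0\le \alpha_{mj}\le 1 .$$ Then there exist real numbers $k_1,\dots,k_m$ such that, for all $\epsilon>0$, there exist positive real numbers $\lambda,\beta,\gamma,L^*$ such that, for all $L\ge L^*$, for all locally bounded time functions $(u,v,w,\hat w)$ and all $(z,\hat z)\in\mathbb R^m\times\mathbb R^m$, any solution $\hat Z(t)=\hat Z(\hat z,z,t;u,v,w,\hat w)$ of the high gain observer $$\dot{\hat z}_i=\hat z_{i+1}+\Phi_i(u,\hat z_1,\dots,\hat z_i)+\hat w_i-L^ik_i(\hat z_1-y)\quad(1\le i\le m-1),$$ $$\dot{\hat z}_m=\Phi_m(u,\hat z)+\hat w_m-L^mk_m(\hat z_1-y)$$ verifies, for all $t\ge t_0\ge 0$ and all $i\in\{1,\dots,m\}$, with $Z(t)=Z(z,t;u,w)$ and $\Delta w=\hat w-w$, $$|\hat Z_i(t)-Z_i(t)|\le\max\left\{\epsilon,\ L^{i-1}\beta\,|\hat Z(t_0)-Z(t_0)|\,e^{-\lambda L(t-t_0)},\ \gamma\sup_{1\le j\le m,\ s\in[t_0,t]}\left\{L^{i-1}|v(s)|,\ \frac{|\Delta w_j(s)|}{L^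{j-i+1}}\right\}\right\}.$$
   Context: System: $\dot z_i=z_{i+1}+\Phi_i(u,z_1,\dots,z_i)+w_i$ for $1\le i\le m-1$, $\dot z_m=\Phi_m(u,z)+w_m$, with measured output $y=z_1+v\in\mathbb R$. Here $z\in\mathbb R^m$ is the state, $u$ the input with values in a set $U\subset\mathbb R^p$, $w(t)\in\mathbb R^m$ a disturbance on the dynamics, $v(t)\in\mathbb R$ a disturbance on the measurement, $\hat w(t)\in\mathbb R^m$ an approximation of $w$. $\Phi_i:\mathbb R^p\times\mathbb R^i\to\mathbb R$ is continuous (not assumed locally Lipschitz). All time functions are measurable and locally bounded on $[0,+\infty)$. $Z(z,t;u,w)$ denotes a solution of the system equal to $z$ at time $0$; standing assumption: such solutions are defined for all $t\ge0$. $\hat Z(\hat z,z,t;u,v,w,\hat w)$ denotes a solution of the observer equal to $\hat z$ at time $0$ and driven by $u$, $\hat w$ and $y(t)=Z_1(z,t;u,w)+v(t)$. Property $\mathcal P(\alpha,\mathfrak a)$, with $\alpha=(\alpha_{ij})_{1\le j\le i\le m}$: for all $i\in\{1,\dots,m\}$, all $(z_{1a},\dots,z_{ia})$ and $(z_{1b},\dots,z_{ib})$ in $\mathbb R^i$ and all $u\in U$, $$|\Phi_i(u,z_{1a},\dots,z_{ia})-\Phi_i(u,z_{1b},\dots,z_{ib})|\le\mathfrak a\sum_{j=1}^i|z_{ja}-z_{jb}|^{\alpha_{ij}}.$$ *)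

theory Defs
  imports "HOL-Analysis.Analysis"
begin

(* A point of R^i is an extensional function on {1..i}; with the product topology
   of nat => real restricted to this set, this is the usual space R^i. *)
definition Rn :: "nat \<Rightarrow> (nat \<Rightarrow> real) set" where
  "Rn i = {1..i} \<rightarrow>\<^sub>E UNIV"

(* Convention 0^0 = 1, whereas 0 powr 0 = 0: exponent 0 in the growth condition
   below expresses boundedness of the increment and nothing more. *)
definition npow :: "real \<Rightarrow> real \<Rightarrow> real" where
  "npow x a = (if a = 0 then 1 else x powr a)"

definition property_P ::
  "nat \<Rightarrow> 'u set \<Rightarrow> (nat \<Rightarrow> 'u \<Rightarrow> (nat \<Rightarrow> real) \<Rightarrow> real) \<Rightarrow> (nat \<Rightarrow> nat \<Rightarrow> real) \<Rightarrow> real \<Rightarrow> bool"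
where
  "property_P m U \<Phi> \<alpha> a \<longleftrightarrow>
     (\<forall>i\<in>{1..m}. \<forall>za\<in>Rn i. \<forall>zb\<in>Rn i. \<forall>u\<in>U.
        \<bar>\<Phi> i u za - \<Phi> i u zb\<bar> \<le> a * (\<Sum>j=1..i. npow \<bar>za j - zb j\<bar> (\<alpha> i j)))"

definition locally_bounded_signal :: "(real \<Rightarrow> 'a::euclidean_space) \<Rightarrow> bool" where
  "locally_bounded_signal f \<longleftrightarrow>
     f \<in> borel_measurable (lebesgue_on {0..}) \<and> (\<forall>T\<ge>0. bounded (f ` {0..T}))"

(* Solutions are in the sense of Caratheodory, the right-hand side being only measurable
   in time: dx_i/dt = F_i(t, x), x(0) = x0 is read as the integral equation, with a
   Lebesgue integrable integrand.  I is meant to be an interval contained in {0..}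
   with 0 in I, and only the components 1..m are relevant. *)
definition caratheodory_solution ::
  "real set \<Rightarrow> nat \<Rightarrow> (real \<Rightarrow> (nat \<Rightarrow> real) \<Rightarrow> nat \<Rightarrow> real) \<Rightarrow> (nat \<Rightarrow> real) \<Rightarrow> (real \<Rightarrow> nat \<Rightarrow> real) \<Rightarrow> bool"
where
  "caratheodory_solution I m F x0 x \<longleftrightarrow>
     (\<forall>i\<in>{1..m}. \<forall>t\<in>I.
        (\<lambda>s. F s (x s) i) absolutely_integrable_on {0..t} \<and>
        x t i = x0 i + integral {0..t} (\<lambda>s. F s (x s) i))"

definition triangular_field ::
  "nat \<Rightarrow> (nat \<Rightarrow> 'u \<Rightarrow> (nat \<Rightarrow> real) \<Rightarrow> real) \<Rightarrow> 'u \<Rightarrow> (nat \<Rightarrow> real) \<Rightarrow> nat \<Rightarrow> real"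
where
  "triangular_field m \<Phi> u x i = (if i < m then x (i + 1) else 0) + \<Phi> i u (restrict x {1..i})"

definition system_solution ::
  "real set \<Rightarrow> nat \<Rightarrow> (nat \<Rightarrow> 'u \<Rightarrow> (nat \<Rightarrow> real) \<Rightarrow> real) \<Rightarrow> (real \<Rightarrow> 'u) \<Rightarrow> (real \<Rightarrow> nat \<Rightarrow> real)
    \<Rightarrow> (nat \<Rightarrow> real) \<Rightarrow> (real \<Rightarrow> nat \<Rightarrow> real) \<Rightarrow> bool"
where
  "system_solution I m \<Phi> u w z Z \<longleftrightarrow>
     caratheodory_solution I m (\<lambda>t x i. triangular_field m \<Phi> (u t) x i + w t i) z Z"

definition observer_solution ::
  "real set \<Rightarrow> nat \<Rightarrow> (nat \<Rightarrow> 'u \<Rightarrow> (nat \<Rightarrow> real) \<Rightarrow> real) \<Rightarrow> (nat \<Rightarrow> real) \<Rightarrow> real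
    \<Rightarrow> (real \<Rightarrow> 'u) \<Rightarrow> (real \<Rightarrow> real) \<Rightarrow> (real \<Rightarrow> nat \<Rightarrow> real)
    \<Rightarrow> (nat \<Rightarrow> real) \<Rightarrow> (real \<Rightarrow> nat \<Rightarrow> real) \<Rightarrow> bool"
where
  "observer_solution I m \<Phi> k L u y w' z' Z' \<longleftrightarrow>
     caratheodory_solution I m
       (\<lambda>t x i. triangular_field m \<Phi> (u t) x i + w' t i - L ^ i * k i * (x 1 - y t)) z' Z'"

end

theory Submission
  imports Defs
begin

text \<open>Take \<open>k\<^sub>i\<close> to be the coefficient of \<open>s^(m-i)\<close> in \<open>(s+1)\<dots>(s+m)\<close>. With \<open>e = Z' - Z\<close>, the linear part
  of the dynamics of the scaled error \<open>e\<^sub>i / L^(i-1)\<close> then has the eigenvalues \<open>-L, \<dots>, -mL\<close>, and it is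
  diagonal in the coordinates \<open>\<xi>\<^sub>r = \<Sum>\<^sub>i (-r)^(m-i) e\<^sub>i / L^(i-1)\<close>, an invertible Vandermonde change
  of variables. Let \<open>N = \<Sum>\<^sub>r |\<xi>\<^sub>r|\<close>. The lower bounds on the exponents say exactly that, as long as \<open>N\<close>
  exceeds a multiple of \<open>\<epsilon> / L^(m-1)\<close>, the increments of \<open>\<Phi>\<close> are dominated by a small multiple of
  \<open>L N\<close> when \<open>L\<close> is large. Hence \<open>N\<close> decays at the rate \<open>L/2\<close> until it falls below the larger of this
  threshold and a multiple of the disturbances, and it never exceeds that level again.\<close>

subsection \<open>Exponential decay from integral equations\<close>

lemma has_integral_increments_continuous_on:
  fixes f F :: "real \<Rightarrow> real"
  assumes "a \<le> b" and int: "\<And>t. a \<le> t \<Longrightarrow> t \<le> b \<Longrightarrow> (F has_integral f t - f a) {a..t}"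
  shows "continuous_on {a..b} f"
proof (rule continuous_on_eq)
  show "continuous_on {a..b} (\<lambda>t. f a + integral {a..t} F)"
    using int[OF \<open>a \<le> b\<close>] by (intro continuous_intros indefinite_integral_continuous_1) blast
  show "f a + integral {a..t} F = f t" if "t \<in> {a..b}" for t
    using integral_unique[OF int, of t] that by simp
qed

text \<open>The components are only known through integral equations with integrable right-hand side, so
  no derivative is available. On a step of length \<open>h\<close> the assumptions give
  \<open>N (s + h) \<le> (1 - c h) N s + o(h)\<close> uniformly in \<open>s\<close>; summing over a fine subdivision gives the
  exponential bound.\<close>

lemma exponential_decay:
  fixes x F :: "'r \<Rightarrow> real \<Rightarrow> real" and \<nu> :: "'r \<Rightarrow> real"
  assumes fin: "finite R" and "a \<le> b" and "0 \<le> \<kappa>" and "0 \<le> c"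
    and int: "\<And>r s t. r \<in> R \<Longrightarrow> a \<le> s \<Longrightarrow> s \<le> t \<Longrightarrow> t \<le> b \<Longrightarrow> (F r has_integral x r t - x r s) {s..t}"
    and rate: "\<And>r. r \<in> R \<Longrightarrow> c + \<kappa> * real (card R) \<le> \<nu> r"
    and dom: "\<And>r s. r \<in> R \<Longrightarrow> s \<in> {a..b} \<Longrightarrow> \<bar>F r s + \<nu> r * x r s\<bar> \<le> \<kappa> * (\<Sum>q\<in>R. \<bar>x q s\<bar>)"
  shows "(\<Sum>r\<in>R. \<bar>x r b\<bar>) \<le> (\<Sum>r\<in>R. \<bar>x r a\<bar>) * exp (- c * (b - a))"
proof -
  define N where "N = (\<lambda>t. \<Sum>r\<in>R. \<bar>x r t\<bar>)"
  define n where "n = real (card R)"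
  have N0: "0 \<le> N t" for t unfolding N_def by (simp add: sum_nonneg)
  have \<nu>0: "0 \<le> \<nu> r" if "r \<in> R" for r
    using rate[OF that] assms(3,4) by (smt (verit) mult_nonneg_nonneg of_nat_0_le_iff)
  have cont: "continuous_on {a..b} (x r)" if "r \<in> R" for r
    using int[OF that] \<open>a \<le> b\<close> by (intro has_integral_increments_continuous_on[where F="F r"]) auto
  \<comment> \<open>\<open>K * \<eta>\<close> is the total, per unit of time, of the errors made by
    freezing the state over a step during which each component moves by at most
    \<open>\<eta>\<close>.\<close>
  define K where "K = (\<Sum>r\<in>R. \<nu> r + \<kappa> * n)"
  have K0: "0 \<le> K" unfolding K_def n_def using \<nu>0 \<open>0 \<le> \<kappa>\<close> by (intro sum_nonneg) auto
  \<comment> \<open>Two conditions select \<open>h\<close>: uniform continuity of the finitely many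
    components makes them move by at most \<open>\<eta>\<close>, and
    \<open>\<nu> r * h \<le> 1\<close> keeps \<open>1 - \<nu> r * (t - s)\<close> nonnegative, so
    that this factor comes out of the absolute value.\<close>
  have step: "\<exists>h>0. \<forall>s t. a \<le> s \<and> s \<le> t \<and> t \<le> b \<and> t - s \<le> h \<longrightarrow>
      N t \<le> N s * (1 - c * (t - s)) + K * \<eta> * (t - s)" if "\<eta> > 0" for \<eta>
  proof -
    have "\<forall>\<^sub>F h in at_right 0. \<nu> r * h \<le> 1 \<and>
        (\<forall>s t. a \<le> s \<and> s \<le> t \<and> t \<le> b \<and> t - s \<le> h \<longrightarrow> \<bar>x r t - x r s\<bar> \<le> \<eta>)" if "r \<in> R" for r
    proof -
      have "uniformly_continuous_on {a..b} (x r)"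
        using cont[OF that] by (intro compact_uniformly_continuous) auto
      then obtain d where d: "d > 0"
        and dd: "\<And>s t. s \<in> {a..b} \<Longrightarrow> t \<in> {a..b} \<Longrightarrow> dist t s < d \<Longrightarrow> dist (x r t) (x r s) < \<eta>"
        using \<open>\<eta> > 0\<close> unfolding uniformly_continuous_on_def by metis
      have "\<bar>x r t - x r s\<bar> \<le> \<eta>" if "a \<le> s" "s \<le> t" "t \<le> b" "t - s < d" for s t
        using dd[of s t] that by (simp add: dist_real_def)
      then have ev: "\<nu> r * h \<le> 1 \<and> (\<forall>s t. a \<le> s \<and> s \<le> t \<and> t \<le> b \<and> t - s \<le> h \<longrightarrow> \<bar>x r t - x r s\<bar> \<le> \<eta>)"
        if "0 < h" "h < min d (1 / (\<nu> r + 1))" for h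
        using that \<nu>0[OF \<open>r \<in> R\<close>] by (auto simp: field_simps)
      have "0 < min d (1 / (\<nu> r + 1))" using d \<nu>0[OF \<open>r \<in> R\<close>] by simp
      then show ?thesis unfolding eventually_at_right_field using ev by blast
    qed
    then have "\<forall>\<^sub>F h in at_right 0. \<forall>r\<in>R. \<nu> r * h \<le> 1 \<and>
        (\<forall>s t. a \<le> s \<and> s \<le> t \<and> t \<le> b \<and> t - s \<le> h \<longrightarrow> \<bar>x r t - x r s\<bar> \<le> \<eta>)"
      using fin by (simp add: eventually_ball_finite)
    then obtain h where "h > 0" and h1: "\<And>r. r \<in> R \<Longrightarrow> \<nu> r * h \<le> 1"
      and h2: "\<And>r s t. r \<in> R \<Longrightarrow> a \<le> s \<Longrightarrow> s \<le> t \<Longrightarrow> t \<le> b \<Longrightarrow> t - s \<le> h \<Longrightarrow> \<bar>x r t - x r s\<bar> \<le> \<eta>"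
      unfolding eventually_at_right_field by (metis field_lbound_gt_zero zero_less_one)
    have "N t \<le> N s * (1 - c * (t - s)) + K * \<eta> * (t - s)"
      if st: "a \<le> s" "s \<le> t" "t \<le> b" "t - s \<le> h" for s t
    proof -
      have "\<bar>x r t\<bar> \<le> \<bar>x r s\<bar> * (1 - (c + \<kappa> * n) * (t - s)) + \<kappa> * N s * (t - s) + (\<nu> r + \<kappa> * n) * \<eta> * (t - s)"
        if r: "r \<in> R" for r
      proof -
        let ?B = "\<kappa> * (N s + n * \<eta>) + \<nu> r * \<eta>"
        \<comment> \<open>On the whole step \<open>F r\<close> is compared with the constant
          \<open>- \<nu> r * x r s\<close>. This costs \<open>\<nu> r * \<eta>\<close> for the drift
          and, in the coupling term, \<open>\<eta>\<close> for each of the \<open>n\<close>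
          components.\<close>
        have B: "\<bar>F r \<tau> + \<nu> r * x r s\<bar> \<le> ?B" if \<tau>: "\<tau> \<in> {s..t}" for \<tau>
        proof -
          have close: "\<bar>x q \<tau> - x q s\<bar> \<le> \<eta>" if "q \<in> R" for q
            using h2[OF that, of s \<tau>] st \<tau> by auto
          have "N \<tau> \<le> (\<Sum>q\<in>R. \<bar>x q s\<bar> + \<eta>)"
            unfolding N_def by (rule sum_mono) (use close in force)
          also have "\<dots> = N s + n * \<eta>" by (simp add: N_def n_def sum.distrib)
          finally have "\<kappa> * N \<tau> \<le> \<kappa> * (N s + n * \<eta>)" using \<open>0 \<le> \<kappa>\<close> by (rule mult_left_mono)
          moreover have "\<bar>F r \<tau> + \<nu> r * x r \<tau>\<bar> \<le> \<kappa> * N \<tau>"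
            using dom[OF r, of \<tau>] st \<tau> by (simp add: N_def)
          moreover have "\<bar>\<nu> r * (x r \<tau> - x r s)\<bar> \<le> \<nu> r * \<eta>"
            using close[OF r] \<nu>0[OF r] by (simp add: abs_mult mult_left_mono)
          ultimately show ?thesis by (simp add: algebra_simps)
        qed
        have "((\<lambda>\<tau>. F r \<tau> + \<nu> r * x r s) has_integral (x r t - x r s + (t - s) * (\<nu> r * x r s))) {s..t}"
          using has_integral_add[OF int[OF r st(1-3)] has_integral_const_real[of "\<nu> r * x r s" s t]] st by simp
        then have "norm (x r t - x r s + (t - s) * (\<nu> r * x r s)) \<le> ?B * measure lborel {s..t}"
          by (rule has_integral_bound_real[rotated 2, where S="{}"])
             (use B N0[of s] \<nu>0[OF r] \<open>0 \<le> \<kappa>\<close> \<open>\<eta> > 0\<close> in \<open>auto simp: n_def\<close>)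
        then have "\<bar>x r t - x r s * (1 - \<nu> r * (t - s))\<bar> \<le> ?B * (t - s)"
          using st by (simp add: algebra_simps)
        then have "\<bar>x r t\<bar> \<le> \<bar>x r s * (1 - \<nu> r * (t - s))\<bar> + ?B * (t - s)" by linarith
        moreover have "\<bar>x r s * (1 - \<nu> r * (t - s))\<bar> \<le> \<bar>x r s\<bar> * (1 - (c + \<kappa> * n) * (t - s))"
        proof -
          have "\<nu> r * (t - s) \<le> \<nu> r * h" using st(4) \<nu>0[OF r] by (rule mult_left_mono)
          then have "0 \<le> 1 - \<nu> r * (t - s)" using h1[OF r] by linarith
          moreover have "(c + \<kappa> * n) * (t - s) \<le> \<nu> r * (t - s)"
            using rate[OF r] st by (intro mult_right_mono) (auto simp: n_def)
          ultimately show ?thesis by (simp add: abs_mult mult_left_mono)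
        qed
        ultimately show ?thesis by (simp add: algebra_simps)
      qed
      then have "N t \<le> (\<Sum>r\<in>R. \<bar>x r s\<bar> * (1 - (c + \<kappa> * n) * (t - s)) + \<kappa> * N s * (t - s) + (\<nu> r + \<kappa> * n) * \<eta> * (t - s))"
        unfolding N_def by (intro sum_mono) (simp add: N_def)
      also have "\<dots> = N s * (1 - (c + \<kappa> * n) * (t - s)) + n * (\<kappa> * N s * (t - s)) + K * \<eta> * (t - s)"
        unfolding sum.distrib sum_distrib_right[symmetric] K_def by (simp add: N_def n_def sum.distrib)
      \<comment> \<open>Summation over \<open>r\<close> has produced \<open>n\<close> copies of the
        coupling \<open>\<kappa> * N s\<close>; they cancel the margin \<open>\<kappa> * n\<close>
        in the rate and leave \<open>c\<close>.\<close>
      also have "\<dots> = N s * (1 - c * (t - s)) + K * \<eta> * (t - s)" by (simp add: algebra_simps)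
      finally show ?thesis .
    qed
    then show ?thesis using \<open>h > 0\<close> by blast
  qed
  have "N b \<le> N a * exp (- c * (b - a)) + K * \<eta> * (b - a)" if \<eta>: "\<eta> > 0" for \<eta>
  proof -
    obtain h where "h > 0" and h: "\<And>s t. a \<le> s \<Longrightarrow> s \<le> t \<Longrightarrow> t \<le> b \<Longrightarrow> t - s \<le> h \<Longrightarrow>
        N t \<le> N s * (1 - c * (t - s)) + K * \<eta> * (t - s)"
      using step[OF \<eta>] by blast
    obtain p :: nat where p: "(b - a) / h < real p" using reals_Archimedean2 by blast
    have p0: "real p > 0" using p \<open>a \<le> b\<close> \<open>h > 0\<close> by (smt (verit) divide_nonneg_pos)
    define \<delta> where "\<delta> = (b - a) / real p"
    have \<delta>: "0 \<le> \<delta>" "\<delta> \<le> h" "real p * \<delta> = b - a"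
      using p p0 \<open>a \<le> b\<close> \<open>h > 0\<close> by (auto simp: \<delta>_def field_simps)
    \<comment> \<open>A discrete Gronwall argument on the grid: each step contributes
      \<open>1 - c * \<delta> \<le> exp (- c * \<delta>)\<close>, and earlier errors are multiplied
      by a factor at most 1, so they add up linearly in time.\<close>
    have "N (a + real j * \<delta>) \<le> N a * exp (- c * (real j * \<delta>)) + K * \<eta> * (real j * \<delta>)" if "j \<le> p" for j
      using that
    proof (induction j)
      case (Suc j)
      let ?s = "a + real j * \<delta>"
      have le: "real (Suc j) * \<delta> \<le> b - a"
        unfolding \<delta>(3)[symmetric] using Suc.prems \<delta>(1) by (intro mult_right_mono) auto
      have "N (?s + \<delta>) \<le> N ?s * (1 - c * \<delta>) + K * \<eta> * \<delta>"
        using h[of ?s "?s + \<delta>"] \<delta>(1,2) le by (simp add: algebra_simps)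
      also have "N ?s * (1 - c * \<delta>) \<le> N ?s * exp (- c * \<delta>)"
        using N0 exp_ge_add_one_self[of "- c * \<delta>"] by (intro mult_left_mono) auto
      also have "\<dots> \<le> (N a * exp (- c * (real j * \<delta>)) + K * \<eta> * (real j * \<delta>)) * exp (- c * \<delta>)"
        using Suc by (intro mult_right_mono) auto
      also have "\<dots> = N a * exp (- c * (real (Suc j) * \<delta>)) + K * \<eta> * (real j * \<delta>) * exp (- c * \<delta>)"
        by (simp add: algebra_simps exp_add[symmetric])
      also have "K * \<eta> * (real j * \<delta>) * exp (- c * \<delta>) \<le> K * \<eta> * (real j * \<delta>)"
        using K0 \<open>\<eta> > 0\<close> \<delta>(1) \<open>0 \<le> c\<close> by (intro mult_right_le_one_le) auto
      finally show ?case by (simp add: algebra_simps)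
    qed simp
    from this[of p] show ?thesis using \<delta>(3) by simp
  qed
  note lim = this
  have "N b \<le> N a * exp (- c * (b - a))"
  proof (rule field_le_epsilon)
    fix e :: real assume "e > 0"
    let ?\<eta> = "e / (K * (b - a) + 1)"
    have pos: "0 \<le> K * (b - a)" using K0 \<open>a \<le> b\<close> by simp
    have "K * ?\<eta> * (b - a) = e * (K * (b - a) / (K * (b - a) + 1))" by simp
    also have "\<dots> \<le> e" using pos \<open>e > 0\<close> by (intro mult_left_le) auto
    finally have "K * ?\<eta> * (b - a) \<le> e" .
    moreover have "?\<eta> > 0" using \<open>e > 0\<close> pos by simp
    ultimately show "N b \<le> N a * exp (- c * (b - a)) + e" using lim[of ?\<eta>] by linarith
  qed
  then show ?thesis by (simp add: N_def)
qed

text \<open>If the sum stays above \<open>\<rho>\<close>, plain decay applies on all of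
  \<open>{a..b}\<close>. Otherwise, if it ends above \<open>\<rho>\<close>, consider the last time
  it is at most \<open>\<rho>\<close>: it equals \<open>\<rho>\<close> there, and decay from that
  time on contradicts growth beyond \<open>\<rho>\<close>.\<close>

lemma exponential_decay_to_threshold:
  fixes x F :: "'r \<Rightarrow> real \<Rightarrow> real" and \<nu> :: "'r \<Rightarrow> real"
  assumes fin: "finite R" and "a \<le> b" and "0 \<le> \<kappa>" and "0 \<le> c"
    and int: "\<And>r s t. r \<in> R \<Longrightarrow> a \<le> s \<Longrightarrow> s \<le> t \<Longrightarrow> t \<le> b \<Longrightarrow> (F r has_integral x r t - x r s) {s..t}"
    and rate: "\<And>r. r \<in> R \<Longrightarrow> c + \<kappa> * real (card R) \<le> \<nu> r"
    and dom: "\<And>r s. r \<in> R \<Longrightarrow> s \<in> {a..b} \<Longrightarrow> \<rho> \<le> (\<Sum>q\<in>R. \<bar>x q s\<bar>) \<Longrightarrow>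
      \<bar>F r s + \<nu> r * x r s\<bar> \<le> \<kappa> * (\<Sum>q\<in>R. \<bar>x q s\<bar>)"
  shows "(\<Sum>r\<in>R. \<bar>x r b\<bar>) \<le> max \<rho> ((\<Sum>r\<in>R. \<bar>x r a\<bar>) * exp (- c * (b - a)))"
proof -
  define N where "N = (\<lambda>t. \<Sum>r\<in>R. \<bar>x r t\<bar>)"
  have N0: "0 \<le> N t" for t unfolding N_def by (simp add: sum_nonneg)
  have decay: "N b \<le> N s * exp (- c * (b - s))" if "s \<in> {a..b}" "\<And>t. t \<in> {s..b} \<Longrightarrow> \<rho> \<le> N t" for s
    unfolding N_def
    by (rule exponential_decay[where F=F and \<nu>=\<nu> and \<kappa>=\<kappa>])
       (use that assms in \<open>auto simp: N_def\<close>)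
  have "continuous_on {a..b} (x r)" if "r \<in> R" for r
    using int[OF that] \<open>a \<le> b\<close> by (intro has_integral_increments_continuous_on[where F="F r"]) auto
  then have cont: "continuous_on {a..b} N" unfolding N_def by (intro continuous_intros)
  have "N b \<le> max \<rho> (N a * exp (- c * (b - a)))"
  proof (cases "N b \<le> \<rho> \<or> (\<forall>t\<in>{a..b}. \<rho> \<le> N t)")
    case True
    then show ?thesis using decay[of a] \<open>a \<le> b\<close> by force
  next
    case False
    then obtain s0 where s0: "s0 \<in> {a..b}" "N s0 \<le> \<rho>" and Nb: "\<rho> < N b" by force
    define S where "S = {s \<in> {a..b}. N s \<le> \<rho>}"
    have "closed S" unfolding S_def
      by (rule continuous_on_closed_Collect_le[OF cont]) (auto intro: continuous_intros)
    moreover have "bounded S" by (rule bounded_subset[of "{a..b}"]) (auto simp: S_def)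
    ultimately have "compact S" by (simp add: compact_eq_bounded_closed)
    moreover have "S \<noteq> {}" using s0 by (auto simp: S_def)
    ultimately obtain s where s: "s \<in> S" "\<And>t. t \<in> S \<Longrightarrow> t \<le> s"
      using compact_attains_sup[of S] by metis
    have sab: "s \<in> {a..b}" "N s \<le> \<rho>" using s(1) by (auto simp: S_def)
    \<comment> \<open>Membership in \<open>S\<close> only gives \<open>N s \<le> \<rho>\<close>.
      Equality follows because the intermediate value \<open>\<rho>\<close> is attained at some
      \<open>y \<ge> s\<close>, and maximality of \<open>s\<close> forces
      \<open>y = s\<close>.\<close>
    obtain y where y: "s \<le> y" "y \<le> b" "N y = \<rho>"
      using IVT'[of N s \<rho> b] sab Nb continuous_on_subset[OF cont, of "{s..b}"] by auto
    then have "y = s" using s(2)[of y] sab by (auto simp: S_def)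
    then have Ns: "N s = \<rho>" using y by simp
    have "\<rho> \<le> N t" if "t \<in> {s..b}" for t
    proof (rule ccontr)
      assume "\<not> \<rho> \<le> N t"
      then have "t \<in> S" using that sab by (auto simp: S_def)
      then show False using s(2)[of t] that Ns \<open>\<not> \<rho> \<le> N t\<close> by auto
    qed
    then have "N b \<le> N s * exp (- c * (b - s))" using decay[of s] sab by blast
    also have "\<dots> \<le> N s" using N0 \<open>0 \<le> c\<close> sab by (intro mult_left_le) auto
    finally show ?thesis using Ns by simp
  qed
  then show ?thesis by (simp add: N_def)
qed

subsection \<open>Gains and modal coordinates\<close>

text \<open>Lagrange interpolation writes \<open>p\<close> as the combination of the basis
  polynomials \<open>l r\<close> with weights \<open>poly p r\<close>, so its coefficients depend
  linearly on its values. This stands in for inverting a Vandermonde matrix.\<close>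

lemma coeff_bounded_by_values:
  fixes A :: "real set"
  assumes "finite A"
  shows "\<exists>C>0. \<forall>p n. degree p < card A \<longrightarrow> \<bar>coeff p n\<bar> \<le> C * (\<Sum>r\<in>A. \<bar>poly p r\<bar>)"
proof -
  define l where "l = (\<lambda>r. \<Prod>q\<in>A-{r}. smult (1 / (r - q)) [:-q, 1:])"
  have l: "poly (l r) s = (if s = r then 1 else 0)" if "r \<in> A" "s \<in> A" for r s
    using that assms by (auto simp: l_def poly_prod intro!: prod.neutral prod_zero simp flip: diff_divide_distrib)
  have dl: "degree (l r) \<le> card A - 1" if "r \<in> A" for r
  proof -
    have "degree (l r) \<le> (\<Sum>q\<in>A-{r}. degree (smult (1 / (r - q)) [:-q, 1:]))"
      unfolding l_def using degree_prod_sum_le[of "A-{r}" "\<lambda>q. smult (1 / (r - q)) [:-q, 1:]"] assms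
      by (simp only: comp_def finite_Diff)
    also have "\<dots> \<le> (\<Sum>q\<in>A-{r}. 1)" by (intro sum_mono) simp
    also have "\<dots> = card A - 1" using that assms by simp
    finally show ?thesis .
  qed
  \<comment> \<open>Coefficients of \<open>l r\<close> from \<open>card A\<close> on vanish, so
    finitely many terms bound them all; the summand 1 makes \<open>C\<close> positive even when
    \<open>A\<close> is empty.\<close>
  define C where "C = 1 + (\<Sum>r\<in>A. \<Sum>n<card A. \<bar>coeff (l r) n\<bar>)"
  have C: "C > 0" unfolding C_def by (smt (verit) abs_ge_zero sum_nonneg)
  have lC: "\<bar>coeff (l r) n\<bar> \<le> C" if "r \<in> A" for r n
  proof (cases "n < card A")
    case True
    then have "\<bar>coeff (l r) n\<bar> \<le> (\<Sum>n<card A. \<bar>coeff (l r) n\<bar>)"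
      by (intro member_le_sum) auto
    also have "\<dots> \<le> (\<Sum>r\<in>A. \<Sum>n<card A. \<bar>coeff (l r) n\<bar>)"
      using that assms by (intro member_le_sum) (auto simp: sum_nonneg)
    finally show ?thesis by (simp add: C_def)
  next
    case False
    have "card A > 0" using that assms card_gt_0_iff by blast
    then have "coeff (l r) n = 0" using dl[OF that] False by (intro coeff_eq_0) linarith
    then show ?thesis using C by simp
  qed
  have "\<bar>coeff p n\<bar> \<le> C * (\<Sum>r\<in>A. \<bar>poly p r\<bar>)" if "degree p < card A" for p n
  proof -
    have "p = (\<Sum>r\<in>A. smult (poly p r) (l r))"
    proof (rule poly_eqI_degree)
      fix s assume s: "s \<in> A"
      have "poly (\<Sum>r\<in>A. smult (poly p r) (l r)) s = (\<Sum>r\<in>A. if s = r then poly p r else 0)"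
        unfolding poly_sum by (intro sum.cong) (use s l in auto)
      then show "poly p s = poly (\<Sum>r\<in>A. smult (poly p r) (l r)) s" using s assms by simp
    next
      show "degree p < card A" by (fact that)
      have "degree (\<Sum>r\<in>A. smult (poly p r) (l r)) \<le> card A - 1"
        by (intro degree_sum_le) (use assms dl in \<open>auto intro: order_trans[OF degree_smult_le]\<close>)
      then show "degree (\<Sum>r\<in>A. smult (poly p r) (l r)) < card A" using that by linarith
    qed
    then have "coeff p n = (\<Sum>r\<in>A. poly p r * coeff (l r) n)"
      by (metis (no_types, lifting) coeff_smult coeff_sum sum.cong)
    also have "\<bar>\<dots>\<bar> \<le> (\<Sum>r\<in>A. \<bar>poly p r * coeff (l r) n\<bar>)" by (rule sum_abs)
    also have "\<dots> \<le> (\<Sum>r\<in>A. \<bar>poly p r\<bar> * C)"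
      by (intro sum_mono) (simp add: abs_mult mult_left_mono lC)
    finally show ?thesis by (simp add: sum_distrib_left mult.commute)
  qed
  then show ?thesis using C by blast
qed

text \<open>\<open>modal m r\<close> is the left eigenvector, for the eigenvalue \<open>-r\<close>, of the matrix of
  \<open>x \<mapsto> (x\<^sub>i\<^sub>+\<^sub>1 - k\<^sub>i x\<^sub>1)\<^sub>i\<close> when \<open>k\<close> is the vector of gains below.\<close>

definition modal :: "nat \<Rightarrow> nat \<Rightarrow> (nat \<Rightarrow> real) \<Rightarrow> real" where
  "modal m r x = (\<Sum>i=1..m. (- real r) ^ (m - i) * x i)"

definition gain :: "nat \<Rightarrow> nat \<Rightarrow> real" where
  "gain m i = coeff (\<Prod>r=1..m. [:real r, 1:]) (m - i)"

text \<open>\<open>modal m r x\<close> is the value at \<open>- r\<close> of the polynomial whose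
  coefficient in degree \<open>m - i\<close> is \<open>x i\<close>. The \<open>m\<close> nodes are
  distinct, so these values control the coefficients.\<close>

lemma modal_norm_equiv:
  "\<exists>C>0. \<forall>x. \<forall>i\<in>{1..m}. \<bar>x i\<bar> \<le> C * (\<Sum>r=1..m. \<bar>modal m r x\<bar>)"
proof -
  let ?A = "(\<lambda>r. - real r) ` {1..m}"
  have inj: "inj_on (\<lambda>r. - real r) {1..m}" by (auto intro: inj_onI)
  have card: "card ?A = m" using inj by (simp add: card_image)
  obtain C where C: "C > 0" "\<And>p n. degree p < m \<Longrightarrow> \<bar>coeff p n\<bar> \<le> C * (\<Sum>r\<in>?A. \<bar>poly p r\<bar>)"
    using coeff_bounded_by_values[of ?A] card by auto
  have "\<bar>x i\<bar> \<le> C * (\<Sum>r=1..m. \<bar>modal m r x\<bar>)" if i: "i \<in> {1..m}" for x i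
  proof -
    define p where "p = (\<Sum>i=1..m. monom (x i) (m - i))"
    have "degree p \<le> m - 1" unfolding p_def
      by (intro degree_sum_le) (auto intro: order_trans[OF degree_monom_le])
    then have "degree p < m" using i by auto
    moreover have "coeff p (m - i) = (\<Sum>j=1..m. if j = i then x j else 0)"
      unfolding p_def coeff_sum by (intro sum.cong) (use i in auto)
    then have "coeff p (m - i) = x i" using i by simp
    moreover have "poly p (- real r) = modal m r x" for r
      by (simp add: p_def modal_def poly_sum poly_monom mult.commute)
    moreover have "(\<Sum>r\<in>?A. \<bar>poly p r\<bar>) = (\<Sum>r=1..m. \<bar>poly p (- real r)\<bar>)"
      by (simp only: sum.reindex[OF inj] comp_def)
    ultimately show ?thesis using C(2)[of p "m - i"] by simp
  qed
  then show ?thesis using C(1) by blast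
qed

text \<open>The converse comparison to \<open>modal_norm_equiv\<close>, with a crude constant: every
  weight \<open>r ^ (m - i)\<close> is at most \<open>m ^ m\<close>.\<close>

lemma modal_abs_le:
  assumes "r \<in> {1..m}"
  shows "\<bar>modal m r x\<bar> \<le> real m ^ m * (\<Sum>i=1..m. \<bar>x i\<bar>)"
proof -
  have "\<bar>(- real r) ^ (m - i)\<bar> \<le> real m ^ m" for i
  proof -
    have "real r ^ (m - i) \<le> real m ^ (m - i)" using assms by (intro power_mono) auto
    also have "\<dots> \<le> real m ^ m" using assms by (intro power_increasing) auto
    finally show ?thesis by (simp add: power_abs)
  qed
  then have "(\<Sum>i=1..m. \<bar>(- real r) ^ (m - i) * x i\<bar>) \<le> (\<Sum>i=1..m. real m ^ m * \<bar>x i\<bar>)"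
    by (intro sum_mono) (simp add: abs_mult mult_right_mono)
  then show ?thesis unfolding modal_def sum_distrib_left by (rule order_trans[OF sum_abs])
qed

text \<open>The gains are the lower coefficients of a monic polynomial of degree \<open>m\<close>
  with root \<open>- r\<close>; the leading term is moved to the right.\<close>

lemma gain_root:
  assumes "r \<in> {1..m}"
  shows "(\<Sum>i=1..m. (- real r) ^ (m - i) * gain m i) = - ((- real r) ^ m)"
proof -
  define p where "p = (\<Prod>r=1..m. [:real r, 1:])"
  have deg: "degree p = m" unfolding p_def by (subst degree_prod_eq_sum_degree) auto
  have "lead_coeff p = 1" unfolding p_def by (subst lead_coeff_prod) simp
  then have lc: "coeff p m = 1" using deg by simp
  have "poly p (- real r) = 0" using assms by (auto simp: p_def poly_prod)
  then have "0 = (\<Sum>n\<le>m. coeff p n * (- real r) ^ n)" unfolding poly_altdef deg by simp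
  also have "\<dots> = (- real r) ^ m + (\<Sum>n<m. coeff p n * (- real r) ^ n)"
    unfolding lessThan_Suc_atMost[symmetric] sum.lessThan_Suc lc by simp
  also have "(\<Sum>n<m. coeff p n * (- real r) ^ n) = (\<Sum>i=1..m. coeff p (m - i) * (- real r) ^ (m - i))"
    by (rule sum.reindex_bij_witness[of _ "\<lambda>i. m - i" "\<lambda>i. m - i"]) auto
  also have "\<dots> = (\<Sum>i=1..m. (- real r) ^ (m - i) * gain m i)"
    unfolding gain_def p_def[symmetric] by (simp only: mult.commute)
  finally show ?thesis by linarith
qed

text \<open>In the polynomial picture the shift multiplies by \<open>- r\<close> and drops the top
  term \<open>(- r) ^ m * x 1\<close>. By \<open>gain_root\<close>, the gain term puts exactly this
  term back.\<close>

lemma modal_eigen: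
  assumes "r \<in> {1..m}"
  shows "modal m r (\<lambda>i. (if i < m then x (i + 1) else 0) - gain m i * x 1) = - real r * modal m r x"
proof -
  obtain n where n: "m = Suc n" using assms by (cases m) auto
  let ?s = "- real r"
  have head: "(\<Sum>i=2..m. ?s ^ (m - i) * x i) = modal m r x - ?s ^ n * x 1"
    unfolding modal_def by (subst (2) sum.atLeast_Suc_atMost) (auto simp: n numeral_2_eq_2)
  have "(\<Sum>i=1..m. ?s ^ (m - i) * (if i < m then x (i + 1) else 0)) = (\<Sum>i=1..n. ?s ^ (m - i) * x (i + 1))"
    by (simp add: n)
  also have "\<dots> = (\<Sum>i=2..m. ?s * (?s ^ (m - i) * x i))"
    by (rule sum.reindex_bij_witness[of _ "\<lambda>i. i - 1" "\<lambda>i. i + 1"])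
       (auto simp: n Suc_diff_le simp flip: power_Suc mult.assoc)
  also have "\<dots> = ?s * (modal m r x - ?s ^ n * x 1)"
    unfolding sum_distrib_left[symmetric] head by simp
  finally have shift: "(\<Sum>i=1..m. ?s ^ (m - i) * (if i < m then x (i + 1) else 0)) = ?s * modal m r x - ?s ^ m * x 1"
    by (simp add: n algebra_simps)
  have "(\<Sum>i=1..m. ?s ^ (m - i) * (gain m i * x 1)) = (\<Sum>i=1..m. ?s ^ (m - i) * gain m i) * x 1"
    by (simp add: sum_distrib_right mult.assoc)
  then show ?thesis
    using shift gain_root[OF assms] unfolding modal_def[of m r "\<lambda>i. _ i - _ i"] right_diff_distrib sum_subtractf
    by simp
qed

subsection \<open>Absorbing the nonlinearity\<close>

lemma npow_mono:
  assumes "0 \<le> x" "x \<le> y" "0 \<le> p"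
  shows "npow x p \<le> npow y p"
  using assms by (simp add: npow_def powr_mono2)

text \<open>The left side grows in \<open>N\<close> like a power \<open>p \<le> 1\<close>, the right
  side linearly, so the smallest admissible \<open>N\<close> is the worst case. There a negative
  power of \<open>L\<close> decides.\<close>

lemma growth_absorbed:
  fixes p C \<rho> \<delta> :: real
  assumes ij: "j \<le> i" "1 \<le> j" "i \<le> m" and p: "0 \<le> p" "p \<le> 1"
    and lower: "i < m \<Longrightarrow> (real m - real i - 1) / (real m - real i) < p"
    and pos: "C > 0" "\<rho> > 0" "\<delta> > 0"
  shows "\<forall>\<^sub>F L in at_top. \<forall>N. \<rho> / L ^ (m - 1) \<le> N \<longrightarrow>
    npow (L ^ (j - 1) * (C * N)) p / L ^ (i - 1) \<le> \<delta> * (L * N)"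
proof -
  \<comment> \<open>At the threshold \<open>N = \<rho> / L^(m-1)\<close>, the left side divided by \<open>L N\<close> is a constant times \<open>L^\<theta>\<close>.\<close>
  define \<theta> where "\<theta> = real m - 1 - real i - (real m - real j) * p"
  \<comment> \<open>For \<open>i < m\<close> the lower bound on \<open>p\<close> gives
    \<open>m - i - 1 < p * (m - i)\<close>, and \<open>j \<le> i\<close> enlarges the right side to
    \<open>p * (m - j)\<close>. For \<open>i = m\<close> the terms without \<open>p\<close> already
    sum to -1.\<close>
  have "\<theta> < 0"
  proof (cases "i < m")
    case True
    have "real m - real i - 1 < p * (real m - real i)"
      using lower[OF True] True by (simp add: divide_less_eq)
    also have "\<dots> \<le> p * (real m - real j)" using ij p by (intro mult_left_mono) auto
    finally show ?thesis by (simp add: \<theta>_def mult.commute)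
  next
    case False
    moreover have "0 \<le> (real m - real j) * p" using ij p by simp
    ultimately show ?thesis using ij by (simp add: \<theta>_def)
  qed
  define D where "D = (C * \<rho>) powr p / \<rho>"
  have "((\<lambda>L::real. D * L powr \<theta>) \<longlongrightarrow> D * 0) at_top"
    using \<open>\<theta> < 0\<close> by (intro tendsto_intros tendsto_neg_powr filterlim_ident)
  then have "\<forall>\<^sub>F L in at_top. D * L powr \<theta> < \<delta>"
    using \<open>\<delta> > 0\<close> by (simp add: order_tendsto_iff)
  moreover have "\<forall>\<^sub>F L::real in at_top. L \<ge> 1" by (rule eventually_ge_at_top)
  ultimately show ?thesis
  proof eventually_elim
    case (elim L)
    have L: "L > 0" "L \<noteq> 0" using elim by auto
    show ?case
    proof (intro allI impI)
      fix N assume N: "\<rho> / L ^ (m - 1) \<le> N"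
      have N0: "N > 0" using N pos L by (smt (verit) divide_pos_pos zero_less_power)
      \<comment> \<open>\<open>y \<ge> 1\<close> measures \<open>N\<close> in units of the
        threshold; \<open>p \<le> 1\<close> then enters through
        \<open>y powr p \<le> y\<close>.\<close>
      define y where "y = L ^ (m - 1) * N / \<rho>"
      have y: "y \<ge> 1" using N pos L by (simp add: y_def field_simps)
      have pw: "L ^ q = L powr real q" for q using L by (simp add: powr_realpow)
      have Ny: "N = \<rho> * y / L ^ (m - 1)" using L pos by (simp add: y_def)
      have arg: "L ^ (j - 1) * (C * N) = (C * \<rho>) * (y * L powr (real j - real m))"
        using ij unfolding Ny pw by (simp add: of_nat_diff powr_diff field_simps)
      have "npow (L ^ (j - 1) * (C * N)) p \<le> (L ^ (j - 1) * (C * N)) powr p"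
        using N0 pos L by (simp add: npow_def)
      also have "\<dots> = (C * \<rho>) powr p * y powr p * L powr ((real j - real m) * p)"
        unfolding arg using pos y by (simp add: powr_mult powr_powr mult.assoc)
      also have "\<dots> \<le> (C * \<rho>) powr p * y * L powr ((real j - real m) * p)"
        using y p powr_mono[of p 1 y] by (intro mult_right_mono mult_left_mono) auto
      finally have "npow (L ^ (j - 1) * (C * N)) p / L ^ (i - 1)
          \<le> (C * \<rho>) powr p * y * L powr ((real j - real m) * p) / L ^ (i - 1)"
        using L by (intro divide_right_mono) auto
      also have "\<dots> = D * N * (L powr (real m - 1) * L powr ((real j - real m) * p) / L powr (real i - 1))"
        unfolding D_def y_def pw using ij by (simp add: of_nat_diff)
      also have "\<dots> = D * N * (L * L powr \<theta>)"
      proof -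
        have "L powr (real m - 1) * L powr ((real j - real m) * p) / L powr (real i - 1) = L powr (1 + \<theta>)"
          unfolding \<theta>_def powr_add[symmetric] powr_diff[symmetric] by (simp add: algebra_simps)
        then show ?thesis using L by (simp add: powr_add)
      qed
      also have "\<dots> = (D * L powr \<theta>) * (L * N)" by simp
      also have "\<dots> \<le> \<delta> * (L * N)" using elim N0 L by (intro mult_right_mono) auto
      finally show "npow (L ^ (j - 1) * (C * N)) p / L ^ (i - 1) \<le> \<delta> * (L * N)" .
    qed
  qed
qed

subsection \<open>Error dynamics of the observer\<close>

text \<open>Brings the integral equation, which starts at time 0, into the incremental form that the
  decay lemmas take.\<close>

lemma caratheodory_solution_increment:
  assumes "caratheodory_solution I m F x0 x" "i \<in> {1..m}" "s \<in> I" "t \<in> I" "0 \<le> s" "s \<le> t"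
  shows "((\<lambda>\<tau>. F \<tau> (x \<tau>) i) has_integral x t i - x s i) {s..t}"
proof -
  let ?f = "\<lambda>\<tau>. F \<tau> (x \<tau>) i"
  have f: "?f integrable_on {0..t}"
    and t: "x t i = x0 i + integral {0..t} ?f" and s: "x s i = x0 i + integral {0..s} ?f"
    using assms unfolding caratheodory_solution_def absolutely_integrable_on_def by blast+
  have "?f integrable_on {s..t}" using f assms by (auto intro: integrable_on_subinterval)
  moreover have "integral {0..s} ?f + integral {s..t} ?f = integral {0..t} ?f"
    using assms f by (intro Henstock_Kurzweil_Integration.integral_combine) auto
  ultimately show ?thesis using t s by (simp add: has_integral_iff)
qed

lemma modal_cong:
  "(\<And>i. i \<in> {1..m} \<Longrightarrow> x i = y i) \<Longrightarrow> modal m r x = modal m r y"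
  by (simp add: modal_def)

lemma modal_linear: "modal m r (\<lambda>i. c * x i + y i) = c * modal m r x + modal m r y"
  by (simp add: modal_def sum.distrib sum_distrib_left algebra_simps)

lemma modal_has_integral:
  assumes "\<And>i. i \<in> {1..m} \<Longrightarrow> ((\<lambda>s. f s i) has_integral y i) A"
  shows "((\<lambda>s. modal m r (f s)) has_integral modal m r y) A"
  unfolding modal_def using assms by (intro has_integral_sum has_integral_mult_right) auto

text \<open>Dividing component \<open>i\<close> by \<open>L ^ (i - 1)\<close> turns the shift into
  \<open>L\<close> times the shift and the gain \<open>L ^ i * k i\<close> into
  \<open>L * k i\<close>. The linear part becomes \<open>L\<close> times the matrix of
  \<open>modal_eigen\<close>; only the perturbation \<open>p\<close> and the noise \<open>v\<close>
  remain.\<close>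

lemma modal_error_rate:
  assumes r: "r \<in> {1..m}" and "L > 0"
  shows "modal m r (\<lambda>i. ((if i < m then e (i + 1) else 0) + p i - L ^ i * gain m i * (e 1 - v)) / L ^ (i - 1))
      + real r * L * modal m r (\<lambda>i. e i / L ^ (i - 1))
    = modal m r (\<lambda>i. p i / L ^ (i - 1) + L * gain m i * v)" (is "?lhs + _ = ?rhs")
proof -
  let ?x = "\<lambda>i. e i / L ^ (i - 1)"
  have "?lhs = modal m r (\<lambda>i. L * ((if i < m then ?x (i + 1) else 0) - gain m i * ?x 1)
      + (p i / L ^ (i - 1) + L * gain m i * v))"
  proof (rule modal_cong)
    fix i assume "i \<in> {1..m}"
    then obtain n where "i = Suc n" by (cases i) auto
    then show "((if i < m then e (i + 1) else 0) + p i - L ^ i * gain m i * (e 1 - v)) / L ^ (i - 1)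
        = L * ((if i < m then ?x (i + 1) else 0) - gain m i * ?x 1) + (p i / L ^ (i - 1) + L * gain m i * v)"
      using \<open>L > 0\<close> by (simp add: field_simps)
  qed
  also have "\<dots> = L * (- real r * modal m r ?x) + ?rhs"
    unfolding modal_linear modal_eigen[OF r, of ?x] ..
  finally show ?thesis by simp
qed

text \<open>The decay lemma tolerates a perturbation of \<open>L * N / (2 * m)\<close> in each mode.
  Half of it is allotted to the increments of \<open>\<Phi>\<close>, which \<open>absorb\<close>
  controls above \<open>\<rho> / L ^ (m - 1)\<close>, and half to the disturbances, which explains
  the second threshold.\<close>

lemma modal_error_decay:
  fixes m :: nat and U :: "'u set" and Z Z' w w' :: "real \<Rightarrow> nat \<Rightarrow> real"
  defines "G \<equiv> \<Sum>i=1..m. 1 + \<bar>gain m i\<bar>"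
    and "N \<equiv> \<lambda>L s. \<Sum>r=1..m. \<bar>modal m r (\<lambda>i. (Z' s i - Z s i) / L ^ (i - 1))\<bar>"
  assumes "1 \<le> m" "0 \<le> a" and \<alpha>0: "\<And>i j. 1 \<le> j \<Longrightarrow> j \<le> i \<Longrightarrow> i \<le> m \<Longrightarrow> 0 \<le> \<alpha> i j"
    and P: "property_P m U \<Phi> \<alpha> a"
    and C: "C > 0" "\<And>x i. i \<in> {1..m} \<Longrightarrow> \<bar>x i\<bar> \<le> C * (\<Sum>r=1..m. \<bar>modal m r x\<bar>)"
    and "1 \<le> L"
    and absorb: "\<And>i j N. 1 \<le> j \<Longrightarrow> j \<le> i \<Longrightarrow> i \<le> m \<Longrightarrow> \<rho> / L ^ (m - 1) \<le> N \<Longrightarrow>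
      npow (L ^ (j - 1) * (C * N)) (\<alpha> i j) / L ^ (i - 1) \<le> 1 / (4 * real m ^ 3 * real m ^ m * (a + 1)) * (L * N)"
    and U: "\<And>s. 0 \<le> s \<Longrightarrow> u s \<in> U"
    and sys: "system_solution {0..} m \<Phi> u w z Z"
    and obs: "observer_solution I m \<Phi> (gain m) L u (\<lambda>t. Z t 1 + v t) w' z' Z'"
    and t: "0 \<le> t0" "t0 \<le> t" "{0..t} \<subseteq> I"
    and v: "\<And>s. s \<in> {t0..t} \<Longrightarrow> \<bar>v s\<bar> \<le> S"
    and w: "\<And>s j. s \<in> {t0..t} \<Longrightarrow> j \<in> {1..m} \<Longrightarrow> \<bar>w' s j - w s j\<bar> / L ^ j \<le> S"
  shows "N L t \<le> max (max (\<rho> / L ^ (m - 1)) (4 * real m * real m ^ m * G * S)) (N L t0 * exp (- (L / 2) * (t - t0)))"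
proof -
  define M where "M = real m ^ m"
  define e where "e = (\<lambda>s i. Z' s i - Z s i)"
  define q where "q = (\<lambda>s i. \<Phi> i (u s) (restrict (Z' s) {1..i}) - \<Phi> i (u s) (restrict (Z s) {1..i}))"
  define f where "f = (\<lambda>s i. (if i < m then e s (i + 1) else 0) + (q s i + (w' s i - w s i))
      - L ^ i * gain m i * (e s 1 - v s))"
  define x where "x = (\<lambda>r s. modal m r (\<lambda>i. e s i / L ^ (i - 1)))"
  define F where "F = (\<lambda>r s. modal m r (\<lambda>i. f s i / L ^ (i - 1)))"
  have L: "L > 0" using \<open>1 \<le> L\<close> by simp
  have M1: "M \<ge> 1" using \<open>1 \<le> m\<close> by (simp add: M_def)
  have N: "N L s = (\<Sum>r\<in>{1..m}. \<bar>x r s\<bar>)" for s by (simp add: N_def x_def e_def)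
  \<comment> \<open>The slowest mode has rate \<open>L\<close>: one half is kept as decay rate, the
    other pays for the coupling, since \<open>m * \<kappa> = L / 2\<close>.\<close>
  show ?thesis unfolding N
  proof (rule exponential_decay_to_threshold[where F=F and \<nu>="\<lambda>r. real r * L" and \<kappa>="L / (2 * real m)"])
    show "(F r has_integral x r t' - x r s) {s..t'}" if r: "r \<in> {1..m}" and s: "t0 \<le> s" "s \<le> t'" "t' \<le> t" for r s t'
    proof -
      have "((\<lambda>\<tau>. f \<tau> i) has_integral (e t' i - e s i)) {s..t'}" if i: "i \<in> {1..m}" for i
      proof -
        have "((\<lambda>\<tau>. triangular_field m \<Phi> (u \<tau>) (Z' \<tau>) i + w' \<tau> i - L ^ i * gain m i * (Z' \<tau> 1 - (Z \<tau> 1 + v \<tau>)))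
            has_integral Z' t' i - Z' s i) {s..t'}"
          by (rule caratheodory_solution_increment[OF obs[unfolded observer_solution_def] i]) (use s t in auto)
        moreover have "((\<lambda>\<tau>. triangular_field m \<Phi> (u \<tau>) (Z \<tau>) i + w \<tau> i) has_integral Z t' i - Z s i) {s..t'}"
          by (rule caratheodory_solution_increment[OF sys[unfolded system_solution_def] i]) (use s t in auto)
        ultimately have "((\<lambda>\<tau>. triangular_field m \<Phi> (u \<tau>) (Z' \<tau>) i + w' \<tau> i - L ^ i * gain m i * (Z' \<tau> 1 - (Z \<tau> 1 + v \<tau>))
            - (triangular_field m \<Phi> (u \<tau>) (Z \<tau>) i + w \<tau> i)) has_integral (Z' t' i - Z' s i) - (Z t' i - Z s i)) {s..t'}"
          by (rule has_integral_diff)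
        moreover have "triangular_field m \<Phi> (u \<tau>) (Z' \<tau>) i + w' \<tau> i - L ^ i * gain m i * (Z' \<tau> 1 - (Z \<tau> 1 + v \<tau>))
            - (triangular_field m \<Phi> (u \<tau>) (Z \<tau>) i + w \<tau> i) = f \<tau> i" for \<tau>
          by (simp add: f_def e_def q_def triangular_field_def algebra_simps)
        ultimately show ?thesis by (simp add: e_def algebra_simps)
      qed
      then have "((\<lambda>\<tau>. modal m r (\<lambda>i. f \<tau> i / L ^ (i - 1))) has_integral
          modal m r (\<lambda>i. (e t' i - e s i) / L ^ (i - 1))) {s..t'}"
        by (intro modal_has_integral has_integral_divide)
      moreover have "modal m r (\<lambda>i. (e t' i - e s i) / L ^ (i - 1)) = x r t' - x r s"
        by (simp add: x_def modal_def diff_divide_distrib right_diff_distrib sum_subtractf)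
      ultimately show ?thesis by (simp add: F_def)
    qed
    show "L / 2 + L / (2 * real m) * real (card {1..m}) \<le> real r * L" if "r \<in> {1..m}" for r
      using that L by simp
    show "\<bar>F r s + real r * L * x r s\<bar> \<le> L / (2 * real m) * (\<Sum>q\<in>{1..m}. \<bar>x q s\<bar>)"
      if r: "r \<in> {1..m}" and s: "s \<in> {t0..t}"
        and large: "max (\<rho> / L ^ (m - 1)) (4 * real m * real m ^ m * G * S) \<le> (\<Sum>q\<in>{1..m}. \<bar>x q s\<bar>)" for r s
    proof -
      define n where "n = (\<Sum>q\<in>{1..m}. \<bar>x q s\<bar>)"
      \<comment> \<open>The factors \<open>M\<close> from \<open>modal_abs_le\<close>,
        \<open>m\<close> components, at most \<open>m\<close> terms per growth bound and
        \<open>a\<close> must multiply \<open>\<delta>\<close> to at most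
        \<open>1 / (4 * m)\<close>; \<open>a + 1\<close> allows \<open>a = 0\<close>.\<close>
      define \<delta> where "\<delta> = 1 / (4 * real m ^ 3 * M * (a + 1))"
      have n0: "0 \<le> n" by (simp add: n_def sum_nonneg)
      have nS: "4 * real m * M * G * S \<le> n" and n\<rho>: "\<rho> / L ^ (m - 1) \<le> n"
        using large by (auto simp: n_def M_def)
      have \<delta>0: "0 \<le> \<delta>" using \<open>0 \<le> a\<close> M1 by (simp add: \<delta>_def)
      have ebound: "\<bar>e s j\<bar> \<le> L ^ (j - 1) * (C * n)" if "j \<in> {1..m}" for j
      proof -
        have "\<bar>e s j\<bar> / L ^ (j - 1) \<le> C * n"
          using C(2)[OF that, of "\<lambda>i. e s i / L ^ (i - 1)"] L by (simp add: n_def x_def abs_divide)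
        then show ?thesis using L by (simp add: field_simps)
      qed
      have qbound: "\<bar>q s i\<bar> / L ^ (i - 1) \<le> a * (real m * (\<delta> * (L * n)))" if i: "i \<in> {1..m}" for i
      proof -
        have R: "restrict y {1..i} \<in> Rn i" for y by (simp add: Rn_def)
        have "u s \<in> U" using s t(1) by (intro U) auto
        then have "\<bar>q s i\<bar> \<le> a * (\<Sum>j=1..i. npow \<bar>restrict (Z' s) {1..i} j - restrict (Z s) {1..i} j\<bar> (\<alpha> i j))"
          using P[unfolded property_P_def, rule_format, OF i R R] by (simp only: q_def)
        also have "\<dots> = a * (\<Sum>j=1..i. npow \<bar>e s j\<bar> (\<alpha> i j))"
          by (intro arg_cong[where f="(*) a"] sum.cong) (auto simp: e_def)
        finally have "\<bar>q s i\<bar> / L ^ (i - 1) \<le> a * (\<Sum>j=1..i. npow \<bar>e s j\<bar> (\<alpha> i j)) / L ^ (i - 1)"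
          using L by (intro divide_right_mono) auto
        also have "\<dots> = a * (\<Sum>j=1..i. npow \<bar>e s j\<bar> (\<alpha> i j) / L ^ (i - 1))"
          by (simp flip: sum_divide_distrib)
        also have "\<dots> \<le> a * (\<Sum>j=1..i. \<delta> * (L * n))"
        proof (intro mult_left_mono sum_mono)
          fix j assume j: "j \<in> {1..i}"
          have "npow \<bar>e s j\<bar> (\<alpha> i j) \<le> npow (L ^ (j - 1) * (C * n)) (\<alpha> i j)"
            using ebound[of j] \<alpha>0[of j i] i j by (intro npow_mono) auto
          then have "npow \<bar>e s j\<bar> (\<alpha> i j) / L ^ (i - 1) \<le> npow (L ^ (j - 1) * (C * n)) (\<alpha> i j) / L ^ (i - 1)"
            using L by (intro divide_right_mono) auto
          also have "\<dots> \<le> \<delta> * (L * n)"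
            using absorb[of j i n] i j n\<rho> by (simp add: \<delta>_def M_def)
          finally show "npow \<bar>e s j\<bar> (\<alpha> i j) / L ^ (i - 1) \<le> \<delta> * (L * n)" .
        qed (fact \<open>0 \<le> a\<close>)
        also have "\<dots> \<le> a * (real m * (\<delta> * (L * n)))"
          using i \<delta>0 L n0 \<open>0 \<le> a\<close> by (auto intro!: mult_left_mono mult_right_mono)
        finally show ?thesis .
      qed
      \<comment> \<open>The bound on the disturbances divides by \<open>L ^ i\<close>, one power
        more than the scaling; the extra \<open>L\<close> puts them on the scale of
        \<open>L * n\<close>.\<close>
      have pbound: "\<bar>(q s i + (w' s i - w s i)) / L ^ (i - 1) + L * gain m i * v s\<bar>
          \<le> a * (real m * (\<delta> * (L * n))) + L * S * (1 + \<bar>gain m i\<bar>)" if i: "i \<in> {1..m}" for i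
      proof -
        obtain k where k: "i = Suc k" using i by (cases i) auto
        have "\<bar>(w' s i - w s i) / L ^ (i - 1)\<bar> = L * (\<bar>w' s i - w s i\<bar> / L ^ i)"
          using L by (simp add: k abs_divide)
        also have "\<dots> \<le> L * S" using w[OF s i] L by (intro mult_left_mono) auto
        finally have "\<bar>(w' s i - w s i) / L ^ (i - 1)\<bar> \<le> L * S" .
        moreover have "\<bar>L * gain m i * v s\<bar> \<le> L * S * \<bar>gain m i\<bar>"
          using v[OF s] L by (simp add: abs_mult mult_left_mono mult_right_mono mult.commute)
        moreover have "\<bar>q s i / L ^ (i - 1)\<bar> \<le> a * (real m * (\<delta> * (L * n)))"
          using qbound[OF i] L by (simp add: abs_divide)
        ultimately show ?thesis unfolding add_divide_distrib distrib_left by linarith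
      qed
      have "\<bar>F r s + real r * L * x r s\<bar> = \<bar>modal m r (\<lambda>i. (q s i + (w' s i - w s i)) / L ^ (i - 1) + L * gain m i * v s)\<bar>"
        unfolding F_def x_def f_def
        using modal_error_rate[OF r L, of "e s" "\<lambda>i. q s i + (w' s i - w s i)" "v s"] by (simp only:)
      also have "\<dots> \<le> M * (\<Sum>i=1..m. \<bar>(q s i + (w' s i - w s i)) / L ^ (i - 1) + L * gain m i * v s\<bar>)"
        unfolding M_def by (rule modal_abs_le[OF r])
      also have "\<dots> \<le> M * (\<Sum>i=1..m. a * (real m * (\<delta> * (L * n))) + L * S * (1 + \<bar>gain m i\<bar>))"
        using M1 by (intro mult_left_mono sum_mono pbound) auto
      also have "\<dots> = M * (real m * (a * (real m * (\<delta> * (L * n))))) + M * (L * S * G)"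
        unfolding sum.distrib[of "\<lambda>_. _"] sum_distrib_left[symmetric] G_def by (simp add: ring_distribs)
      also have "M * (real m * (a * (real m * (\<delta> * (L * n))))) \<le> L * n / (4 * real m)"
      proof -
        have "M * (real m * (a * (real m * (\<delta> * (L * n))))) = (a / (a + 1)) * (L * n / (4 * real m))"
          using M1 \<open>1 \<le> m\<close> \<open>0 \<le> a\<close> by (simp add: \<delta>_def power3_eq_cube divide_simps)
        also have "\<dots> \<le> 1 * (L * n / (4 * real m))"
          using \<open>0 \<le> a\<close> L n0 by (intro mult_right_mono) auto
        finally show ?thesis by simp
      qed
      also have "M * (L * S * G) \<le> L * n / (4 * real m)"
      proof -
        have "L * (4 * real m * M * G * S) \<le> L * n" using nS L by (intro mult_left_mono) auto
        then show ?thesis using \<open>1 \<le> m\<close> by (simp add: field_simps)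
      qed
      finally show ?thesis by (simp add: n_def field_simps)
    qed
  qed (use t L in auto)
qed

theorem proposition2:
  fixes m :: nat
    and U :: "(real ^ 'p) set"
    and \<Phi> :: "nat \<Rightarrow> real ^ 'p \<Rightarrow> (nat \<Rightarrow> real) \<Rightarrow> real"
    and \<alpha> :: "nat \<Rightarrow> nat \<Rightarrow> real"
    and a :: real
  assumes "m \<ge> 1"
    and "\<And>i. i \<in> {1..m} \<Longrightarrow> continuous_on (UNIV \<times> Rn i) (\<lambda>(u, z). \<Phi> i u z)"
    and "a \<ge> 0"
    and "\<And>i j. 1 \<le> j \<Longrightarrow> j \<le> i \<Longrightarrow> i \<le> m \<Longrightarrow> 0 \<le> \<alpha> i j \<and> \<alpha> i j \<le> 1"
    and "\<And>i j. 1 \<le> j \<Longrightarrow> j \<le> i \<Longrightarrow> i < m \<Longrightarrow>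
           (real m - real i - 1) / (real m - real i) < \<alpha> i j"
    and "property_P m U \<Phi> \<alpha> a"
  shows "\<exists>k :: nat \<Rightarrow> real. \<forall>\<epsilon>>0. \<exists>lam>0. \<exists>\<beta>>0. \<exists>\<gamma>>0. \<exists>Ls>0. \<forall>L\<ge>Ls.
    \<forall>(u :: real \<Rightarrow> real ^ 'p) (v :: real \<Rightarrow> real) (w :: real \<Rightarrow> nat \<Rightarrow> real) (w' :: real \<Rightarrow> nat \<Rightarrow> real)
      (z :: nat \<Rightarrow> real) (z' :: nat \<Rightarrow> real) (Z :: real \<Rightarrow> nat \<Rightarrow> real) (Z' :: real \<Rightarrow> nat \<Rightarrow> real) (I :: real set).
      locally_bounded_signal u \<longrightarrow> (\<forall>t\<ge>0. u t \<in> U) \<longrightarrow>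
      locally_bounded_signal v \<longrightarrow>
      (\<forall>j\<in>{1..m}. locally_bounded_signal (\<lambda>t. w t j)) \<longrightarrow>
      (\<forall>j\<in>{1..m}. locally_bounded_signal (\<lambda>t. w' t j)) \<longrightarrow>
      z \<in> Rn m \<longrightarrow> z' \<in> Rn m \<longrightarrow>
      system_solution {0..} m \<Phi> u w z Z \<longrightarrow>
      is_interval I \<longrightarrow> 0 \<in> I \<longrightarrow> I \<subseteq> {0..} \<longrightarrow>
      observer_solution I m \<Phi> k L u (\<lambda>t. Z t 1 + v t) w' z' Z' \<longrightarrow>
      (\<forall>t0 t. 0 \<le> t0 \<longrightarrow> t0 \<le> t \<longrightarrow> t \<in> I \<longrightarrow>
        (\<forall>i\<in>{1..m}.
          \<bar>Z' t i - Z t i\<bar> \<le> Max {\<epsilon>,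
            L ^ (i - 1) * \<beta> * L2_set (\<lambda>j. Z' t0 j - Z t0 j) {1..m} * exp (- lam * L * (t - t0)),
            \<gamma> * (SUP (j, s)\<in>{1..m} \<times> {t0..t}.
                   max (L ^ (i - 1) * \<bar>v s\<bar>) (\<bar>w' s j - w s j\<bar> / L powi (int j - int i + 1)))}))"
proof (rule exI[of _ "gain m"], intro allI impI, goal_cases)
  case \<epsilon>: (1 \<epsilon>)
  obtain C where C: "C > 0" "\<And>x i. i \<in> {1..m} \<Longrightarrow> \<bar>x i\<bar> \<le> C * (\<Sum>r=1..m. \<bar>modal m r x\<bar>)"
    using modal_norm_equiv[of m] by blast
  define M where "M = real m ^ m"
  define G where "G = (\<Sum>i=1..m. 1 + \<bar>gain m i\<bar>)"
  \<comment> \<open>Chosen so that the threshold, carried back to a component of the error, is at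
    most \<open>\<epsilon>\<close>. Below, \<open>\<beta>\<close>, \<open>\<gamma>\<close> and the
    rate 1/2 are independent of \<open>\<epsilon>\<close>; it affects only how large
    \<open>L\<close> must be.\<close>
  define \<rho> where "\<rho> = \<epsilon> / C"
  define \<delta> where "\<delta> = 1 / (4 * real m ^ 3 * real m ^ m * (a + 1))"
  \<comment> \<open>\<open>C\<close> returns from modes to components, the outer \<open>m\<close>
    counts the modes, and \<open>M * m\<close> bounds one mode by the Euclidean norm of the initial
    error.\<close>
  define \<beta> where "\<beta> = C * (real m * (M * real m))"
  define \<gamma> where "\<gamma> = C * (4 * real m * M * G)"
  have M: "M > 0" using \<open>m \<ge> 1\<close> by (simp add: M_def)
  have "G > 0" unfolding G_def using \<open>m \<ge> 1\<close> by (intro sum_pos) auto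
  have "\<rho> > 0" using \<open>\<epsilon> > 0\<close> C by (simp add: \<rho>_def)
  have "\<delta> > 0" using \<open>m \<ge> 1\<close> \<open>a \<ge> 0\<close> by (simp add: \<delta>_def)
  have "\<beta> > 0" "\<gamma> > 0" using C M \<open>G > 0\<close> \<open>m \<ge> 1\<close> by (auto simp: \<beta>_def \<gamma>_def)
  have "\<forall>\<^sub>F L in at_top. \<forall>(i, j)\<in>(SIGMA i:{1..m}. {1..i}). \<forall>N. \<rho> / L ^ (m - 1) \<le> N \<longrightarrow>
      npow (L ^ (j - 1) * (C * N)) (\<alpha> i j) / L ^ (i - 1) \<le> \<delta> * (L * N)"
  proof (intro eventually_ball_finite ballI)
    fix p assume "p \<in> (SIGMA i:{1..m}. {1..i})"
    then obtain i j where p: "p = (i, j)" "1 \<le> j" "j \<le> i" "i \<le> m" by auto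
    show "\<forall>\<^sub>F L in at_top. case p of (i, j) \<Rightarrow> \<forall>N. \<rho> / L ^ (m - 1) \<le> N \<longrightarrow>
        npow (L ^ (j - 1) * (C * N)) (\<alpha> i j) / L ^ (i - 1) \<le> \<delta> * (L * N)"
      unfolding p(1) case_prod_conv
      by (rule growth_absorbed) (use p assms(4,5) C(1) \<open>\<rho> > 0\<close> \<open>\<delta> > 0\<close> in auto)
  qed auto
  then obtain L0 where L0: "\<And>L i j N. L \<ge> L0 \<Longrightarrow> 1 \<le> j \<Longrightarrow> j \<le> i \<Longrightarrow> i \<le> m \<Longrightarrow> \<rho> / L ^ (m - 1) \<le> N \<Longrightarrow>
      npow (L ^ (j - 1) * (C * N)) (\<alpha> i j) / L ^ (i - 1) \<le> \<delta> * (L * N)"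
    unfolding eventually_at_top_linorder by fastforce
  show ?case
  proof (rule exI[of _ "1 / 2"], rule conjI, simp, rule exI[of _ \<beta>], rule conjI, fact,
      rule exI[of _ \<gamma>], rule conjI, fact, rule exI[of _ "max 1 L0"], rule conjI, simp,
      intro allI impI ballI)
    fix L t0 t i and u :: "real \<Rightarrow> real ^ 'p" and v w w' z z' Z Z' I
    assume L: "max 1 L0 \<le> L" and U: "\<forall>t\<ge>0. u t \<in> U"
      and sig: "locally_bounded_signal v" "\<forall>j\<in>{1..m}. locally_bounded_signal (\<lambda>t. w t j)"
        "\<forall>j\<in>{1..m}. locally_bounded_signal (\<lambda>t. w' t j)"
      and sys: "system_solution {0..} m \<Phi> u w z Z"
      and I: "is_interval I" "0 \<in> I"
      and obs: "observer_solution I m \<Phi> (gain m) L u (\<lambda>t. Z t 1 + v t) w' z' Z'"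
      and t: "0 \<le> t0" "t0 \<le> t" "t \<in> I" and i: "i \<in> {1..m}"
    define Q where "Q = (\<lambda>(j, s). max (L ^ (i - 1) * \<bar>v s\<bar>) (\<bar>w' s j - w s j\<bar> / L powi (int j - int i + 1)))"
    define \<S> where "\<S> = (SUP p\<in>{1..m} \<times> {t0..t}. Q p)"
    \<comment> \<open>Division by \<open>L ^ (i - 1)\<close> removes the dependence on the estimated
      component: the weights become 1 on \<open>v\<close> and \<open>1 / L ^ j\<close> on the
      disturbance of component \<open>j\<close>.\<close>
    define S where "S = \<S> / L ^ (i - 1)"
    define N where "N = (\<lambda>s. \<Sum>r=1..m. \<bar>modal m r (\<lambda>i. (Z' s i - Z s i) / L ^ (i - 1))\<bar>)"
    have L1: "L \<ge> 1" "L > 0" using L by auto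
    have It: "{0..t} \<subseteq> I" using mem_is_interval_1_I[OF I t(3)] by auto
    have bnd: "\<exists>B. \<forall>s\<in>{t0..t}. \<bar>h s\<bar> \<le> B" if "locally_bounded_signal h" for h :: "real \<Rightarrow> real"
    proof -
      have "bounded (h ` {0..t})" using that t unfolding locally_bounded_signal_def by auto
      then show ?thesis using t(1) by (fastforce simp: bounded_iff)
    qed
    \<comment> \<open>The supremum bounds its members only once the set is known to be bounded; this
      is where local boundedness of the signals enters.\<close>
    have "bdd_above (Q ` ({1..m} \<times> {t0..t}))"
    proof -
      have "bdd_above ((\<lambda>s. Q (j, s)) ` {t0..t})" if j: "j \<in> {1..m}" for j
      proof -
        obtain A B B' where A: "\<forall>s\<in>{t0..t}. \<bar>v s\<bar> \<le> A" and B: "\<forall>s\<in>{t0..t}. \<bar>w s j\<bar> \<le> B"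
          and B': "\<forall>s\<in>{t0..t}. \<bar>w' s j\<bar> \<le> B'"
          using bnd sig j by meson
        have "Q (j, s) \<le> max (L ^ (i - 1) * A) ((B' + B) / L powi (int j - int i + 1))"
          if "s \<in> {t0..t}" for s
        proof -
          have "\<bar>w' s j - w s j\<bar> \<le> B' + B" using that B B' by force
          then show ?thesis
            using that A L1 unfolding Q_def case_prod_conv
            by (intro max.mono mult_left_mono divide_right_mono) auto
        qed
        then show ?thesis by (rule bdd_aboveI2)
      qed
      moreover have "Q ` ({1..m} \<times> {t0..t}) = (\<Union>j\<in>{1..m}. (\<lambda>s. Q (j, s)) ` {t0..t})" by auto
      ultimately show ?thesis by simp
    qed
    then have Q: "Q (j, s) \<le> \<S>" if "j \<in> {1..m}" "s \<in> {t0..t}" for j s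
      unfolding \<S>_def using that by (intro cSUP_upper) auto
    have v: "\<bar>v s\<bar> \<le> S" if "s \<in> {t0..t}" for s
      using Q[OF i that] L1 by (simp add: Q_def S_def field_simps)
    have w: "\<bar>w' s j - w s j\<bar> / L ^ j \<le> S" if "s \<in> {t0..t}" "j \<in> {1..m}" for s j
    proof -
      \<comment> \<open>The exponent \<open>j - i + 1\<close> may be negative, hence the integer
        power; it is split into two natural powers.\<close>
      have "L powi (int j - int i + 1) = L powi (int j - int (i - 1))"
        using i by (intro arg_cong[where f="(powi) L"]) auto
      also have "\<dots> = L ^ j / L ^ (i - 1)" using L1 by (simp add: power_int_diff)
      finally have powi: "L powi (int j - int i + 1) = L ^ j / L ^ (i - 1)" .
      have "\<bar>w' s j - w s j\<bar> / (L ^ j / L ^ (i - 1)) \<le> \<S>"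
        using Q[OF that(2,1)] unfolding Q_def case_prod_conv powi by simp
      then show ?thesis using L1 by (simp add: S_def field_simps)
    qed
    have "N t \<le> max (max (\<rho> / L ^ (m - 1)) (4 * real m * real m ^ m * G * S)) (N t0 * exp (- (L / 2) * (t - t0)))"
      unfolding N_def G_def
    proof (rule modal_error_decay[OF \<open>m \<ge> 1\<close> \<open>a \<ge> 0\<close> _ assms(6) C(1) _ L1(1) _ _ sys obs t(1,2) It])
      show "npow (L ^ (j - 1) * (C * N)) (\<alpha> i j) / L ^ (i - 1)
          \<le> 1 / (4 * real m ^ 3 * real m ^ m * (a + 1)) * (L * N)"
        if "1 \<le> j" "j \<le> i" "i \<le> m" "\<rho> / L ^ (m - 1) \<le> N" for i j N
        using L0[OF _ that] L unfolding \<delta>_def by simp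
    qed (use assms(4) C(2) U v w in auto)
    then consider "N t \<le> \<rho> / L ^ (m - 1)" | "N t \<le> 4 * real m * M * G * S" | "N t \<le> N t0 * exp (- (L / 2) * (t - t0))"
      unfolding M_def by linarith
    moreover have err: "\<bar>Z' t i - Z t i\<bar> \<le> L ^ (i - 1) * (C * N t)"
      using C(2)[OF i, of "\<lambda>i. (Z' t i - Z t i) / L ^ (i - 1)"] L1 by (simp add: N_def abs_divide field_simps)
    ultimately consider "\<bar>Z' t i - Z t i\<bar> \<le> L ^ (i - 1) * (C * (\<rho> / L ^ (m - 1)))"
      | "\<bar>Z' t i - Z t i\<bar> \<le> L ^ (i - 1) * (C * (4 * real m * M * G * S))"
      | "\<bar>Z' t i - Z t i\<bar> \<le> L ^ (i - 1) * (C * (N t0 * exp (- (L / 2) * (t - t0))))"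
      using C(1) L1 by (meson less_imp_le mult_left_mono order_trans zero_le_power)
    then have "\<bar>Z' t i - Z t i\<bar> \<le> max \<epsilon> (max
        (L ^ (i - 1) * \<beta> * L2_set (\<lambda>j. Z' t0 j - Z t0 j) {1..m} * exp (- (1 / 2) * L * (t - t0))) (\<gamma> * \<S>))"
    proof cases
      case 1
      have "L ^ (i - 1) * (C * (\<rho> / L ^ (m - 1))) = \<epsilon> * (L ^ (i - 1) / L ^ (m - 1))"
        using C(1) by (simp add: \<rho>_def)
      also have "\<dots> \<le> \<epsilon>"
        using L1 i \<open>\<epsilon> > 0\<close> by (intro mult_left_le) (auto intro!: power_increasing)
      finally show ?thesis using 1 by linarith
    next
      case 2
      then show ?thesis using L1 by (simp add: S_def \<gamma>_def mult_ac)
    next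
      case 3
      let ?E = "L2_set (\<lambda>j. Z' t0 j - Z t0 j) {1..m}"
      \<comment> \<open>At the initial time the scaling only shrinks the components, as
        \<open>L \<ge> 1\<close>, so no power of \<open>L\<close> beyond \<open>L ^ (i - 1)\<close>
        appears in the transient.\<close>
      have "\<bar>(Z' t0 j - Z t0 j) / L ^ (j - 1)\<bar> \<le> ?E" if "j \<in> {1..m}" for j
      proof -
        have "\<bar>(Z' t0 j - Z t0 j) / L ^ (j - 1)\<bar> \<le> \<bar>Z' t0 j - Z t0 j\<bar>"
          using L1 mult_left_mono[OF one_le_power[OF L1(1), of "j - 1"], of "\<bar>Z' t0 j - Z t0 j\<bar>"]
          by (simp add: abs_divide divide_le_eq)
        also have "\<dots> \<le> L2_set (\<lambda>j. \<bar>Z' t0 j - Z t0 j\<bar>) {1..m}"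
          using that by (intro member_le_L2_set) auto
        finally show ?thesis by (simp add: L2_set_def)
      qed
      then have "(\<Sum>j=1..m. \<bar>(Z' t0 j - Z t0 j) / L ^ (j - 1)\<bar>) \<le> (\<Sum>j=1..m. ?E)" by (rule sum_mono)
      then have "M * (\<Sum>j=1..m. \<bar>(Z' t0 j - Z t0 j) / L ^ (j - 1)\<bar>) \<le> M * (real m * ?E)"
        using M by (intro mult_left_mono) auto
      then have "N t0 \<le> (\<Sum>r=1..m. M * (real m * ?E))"
        unfolding N_def M_def by (intro sum_mono order_trans[OF modal_abs_le])
      then have "L ^ (i - 1) * (C * (N t0 * exp (- (L / 2) * (t - t0))))
          \<le> L ^ (i - 1) * (C * (real m * (M * (real m * ?E)) * exp (- (L / 2) * (t - t0))))"
        using L1 C(1) by (intro mult_left_mono mult_right_mono) auto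
      also have "\<dots> = L ^ (i - 1) * \<beta> * ?E * exp (- (1 / 2) * L * (t - t0))"
        by (simp add: \<beta>_def mult_ac)
      finally show ?thesis using 3 by linarith
    qed
    then show "\<bar>Z' t i - Z t i\<bar> \<le> Max {\<epsilon>,
        L ^ (i - 1) * \<beta> * L2_set (\<lambda>j. Z' t0 j - Z t0 j) {1..m} * exp (- (1 / 2) * L * (t - t0)),
        \<gamma> * (SUP (j, s)\<in>{1..m} \<times> {t0..t}.
               max (L ^ (i - 1) * \<bar>v s\<bar>) (\<bar>w' s j - w s j\<bar> / L powi (int j - int i + 1)))}"
      unfolding \<S>_def Q_def by simp
  qed
qed

end
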